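(* Let $G$ be a connected graph on $n\geq 3$ vertices. Then $\gamma_1^{\mathrm L}(G)=n-1$ if and only if all of the following three conditions hold: (i) $\mathrm{diam}(G)\leq 2$; (ii) every non-pendant edge of $G$ lies in a triangle, or $G$ has a universal vertex; (iii) $G$ contains no subset $S\subseteq V(G)$ with $|S|\ge 3$ such that $\mathrm{epn}(s,S)\neq\emptyset$ for every $s\in S$, and $N(S)=\bigcup_{s\in S}\mathrm{epn}(s,S)$.
   Context: All graphs are finite, simple and undirected; $N(v)$ is the open neighborhood of a vertex $v$, and for $S\subseteq V(G)$, $N(S)$ is the set of vertices in $V(G)-S$ having a neighbor in $S$. $\mathrm{diam}(G)$ is the maximum distance between two vertices of $G$. A dominating set of $G$ is a set $D\subseteq V(G)$ such that every vertex not in $D$ has a neighbor in $D$. A $1$-limited dominating set is a dominating set $D$ with $|N(u)-D|\le 1$ for every $u\in D$; $\gamma_1^{\mathrm L}(G)$ is the minimum cardinality of a $1$-limited dominating set. A pendant edge is an edge with an endvertex of degree $1$; other edges are non-pendant. A universal vertex is a vertex adjacent to every other vertex of the graph. For $S\subseteq V(G)$ and $s\in S$, $\mathrm{epn}(s,S)=\{v\in V(G)-S : N(v)\cap S=\{s\}\}$. *)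

theory Defs
  imports "Graph_Theory.Graph_Theory"
begin

text \<open>
  A finite simple undirected graph is a \<^locale>\<open>graph\<close>: a finite, loop-free, symmetric digraph
  without parallel arcs. An undirected edge is thus represented by two opposite arcs.
\<close>

definition neighborhood :: "('a, 'b) pre_digraph \<Rightarrow> 'a \<Rightarrow> 'a set" where
  "neighborhood G v = {w \<in> verts G. v \<rightarrow>\<^bsub>G\<^esub> w}"

definition set_neighborhood :: "('a, 'b) pre_digraph \<Rightarrow> 'a set \<Rightarrow> 'a set" where
  "set_neighborhood G S = {v \<in> verts G - S. neighborhood G v \<inter> S \<noteq> {}}"

text \<open>With unit weights, the weighted distance of the library is the number of edges of a
  shortest walk.\<close>

definition distance :: "('a, 'b) pre_digraph \<Rightarrow> 'a \<Rightarrow> 'a \<Rightarrow> ereal" where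
  "distance G u v = wf_digraph.\<mu> G (\<lambda>_. 1) u v"

definition diam :: "('a, 'b) pre_digraph \<Rightarrow> ereal" where
  "diam G = Max {distance G u v | u v. u \<in> verts G \<and> v \<in> verts G}"

definition dominating_set :: "('a, 'b) pre_digraph \<Rightarrow> 'a set \<Rightarrow> bool" where
  "dominating_set G D \<longleftrightarrow>
     D \<subseteq> verts G \<and> (\<forall>v \<in> verts G - D. neighborhood G v \<inter> D \<noteq> {})"

definition one_limited_dominating_set :: "('a, 'b) pre_digraph \<Rightarrow> 'a set \<Rightarrow> bool" where
  "one_limited_dominating_set G D \<longleftrightarrow>
     dominating_set G D \<and> (\<forall>u \<in> D. card (neighborhood G u - D) \<le> 1)"

text \<open>The minimum below is over a finite set, which is nonempty as it contains the order of the
  graph, attained by the full vertex set.\<close>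

definition one_limited_domination_number :: "('a, 'b) pre_digraph \<Rightarrow> nat" where
  "one_limited_domination_number G = Min {card D | D. one_limited_dominating_set G D}"

text \<open>In a symmetric digraph without parallel arcs, the out-degree of a vertex is its degree in
  the undirected graph.\<close>

definition pendant_edge :: "('a, 'b) pre_digraph \<Rightarrow> 'b \<Rightarrow> bool" where
  "pendant_edge G e \<longleftrightarrow>
     e \<in> arcs G \<and> (out_degree G (tail G e) = 1 \<or> out_degree G (head G e) = 1)"

definition in_triangle :: "('a, 'b) pre_digraph \<Rightarrow> 'b \<Rightarrow> bool" where
  "in_triangle G e \<longleftrightarrow>
     e \<in> arcs G \<and> (\<exists>w \<in> verts G. tail G e \<rightarrow>\<^bsub>G\<^esub> w \<and> w \<rightarrow>\<^bsub>G\<^esub> head G e)"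

definition universal_vertex :: "('a, 'b) pre_digraph \<Rightarrow> 'a \<Rightarrow> bool" where
  "universal_vertex G u \<longleftrightarrow> u \<in> verts G \<and> (\<forall>v \<in> verts G - {u}. u \<rightarrow>\<^bsub>G\<^esub> v)"

definition epn :: "('a, 'b) pre_digraph \<Rightarrow> 'a \<Rightarrow> 'a set \<Rightarrow> 'a set" where
  "epn G s S = {v \<in> verts G - S. neighborhood G v \<inter> S = {s}}"

end

theory Submission
  imports Defs
begin

text \<open>
  The proof passes to complements. Deleting a set \<open>T\<close> of vertices leaves a 1-limited dominating
  set exactly when every vertex of \<open>T\<close> has a neighbor outside \<open>T\<close> and no vertex outside \<open>T\<close> has
  two neighbors in \<open>T\<close>. This says that every outside neighbor of \<open>T\<close> is private to one vertex of
  \<open>T\<close> and every vertex of \<open>T\<close> has such a neighbor, which is the property of \<open>S\<close> in condition (iii);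
  call such sets private (\<open>one_limited_dominating_set_Diff_iff\<close>). In a connected graph with at
  least two vertices every singleton is private, so the domination number is at most \<open>n - 1\<close>,
  and it equals \<open>n - 1\<close> exactly when no set of two or more vertices is private
  (\<open>one_limited_domination_number_eq_iff\<close>).

  Condition (iii) excludes the private sets with at least three vertices. It remains to read off
  what it means that no pair \<open>{x, y}\<close> is private (\<open>private_set_pair_iff\<close>). In a connected graph,
  a non-adjacent pair is private iff \<open>x\<close> and \<open>y\<close> have no common neighbor, that is, iff their distance exceeds two;
  thus (i) excludes these pairs. An adjacent pair is private iff the edge \<open>xy\<close> is non-pendant and
  lies in no triangle, so the first alternative of (ii) excludes these. The second alternative of
  (ii) is a special case of the first one: a universal vertex completes every non-pendant edge
  to a triangle (\<open>universal_vertex_imp_in_triangle\<close>).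
\<close>

section \<open>Private sets and 1-limited domination\<close>

definition private_set :: "('a, 'b) pre_digraph \<Rightarrow> 'a set \<Rightarrow> bool" where
  "private_set G S \<longleftrightarrow> S \<subseteq> verts G \<and> (\<forall>s \<in> S. epn G s S \<noteq> {}) \<and>
     set_neighborhood G S = (\<Union>s \<in> S. epn G s S)"

context graph
begin

lemma dominates_sym: "u \<rightarrow>\<^bsub>G\<^esub> v \<Longrightarrow> v \<rightarrow>\<^bsub>G\<^esub> u"
  by (rule arcs_ends_symmetric[OF sym_arcs])

lemma mem_neighborhood_iff: "w \<in> neighborhood G v \<longleftrightarrow> v \<rightarrow>\<^bsub>G\<^esub> w"
  unfolding neighborhood_def using adj_in_verts by blast

lemma finite_neighborhood: "finite (neighborhood G v)"
  unfolding neighborhood_def by simp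

lemma mem_epn_iff:
  assumes "s \<in> S"
  shows "v \<in> epn G s S \<longleftrightarrow> v \<notin> S \<and> v \<rightarrow>\<^bsub>G\<^esub> s \<and> (\<forall>t \<in> S. v \<rightarrow>\<^bsub>G\<^esub> t \<longrightarrow> t = s)"
proof -
  have "neighborhood G v \<inter> S = {s} \<longleftrightarrow> v \<rightarrow>\<^bsub>G\<^esub> s \<and> (\<forall>t \<in> S. v \<rightarrow>\<^bsub>G\<^esub> t \<longrightarrow> t = s)"
    using assms mem_neighborhood_iff[of _ v] by blast
  then show ?thesis
    unfolding epn_def using adj_in_verts by blast
qed

lemma mem_set_neighborhood_iff: "v \<in> set_neighborhood G S \<longleftrightarrow> v \<notin> S \<and> (\<exists>s \<in> S. v \<rightarrow>\<^bsub>G\<^esub> s)"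
  unfolding set_neighborhood_def using mem_neighborhood_iff[of _ v] adj_in_verts by blast

text \<open>Once no outside vertex sees two vertices of the set, all outside neighbors are private, so
  that having a private neighbor reduces to having any neighbor outside.\<close>

lemma private_set_iff:
  "private_set G S \<longleftrightarrow> S \<subseteq> verts G \<and> (\<forall>s \<in> S. \<exists>v. v \<notin> S \<and> v \<rightarrow>\<^bsub>G\<^esub> s) \<and>
     (\<forall>v s t. v \<notin> S \<longrightarrow> s \<in> S \<longrightarrow> t \<in> S \<longrightarrow> v \<rightarrow>\<^bsub>G\<^esub> s \<longrightarrow> v \<rightarrow>\<^bsub>G\<^esub> t \<longrightarrow> s = t)"
    (is "_ \<longleftrightarrow> _ \<and> ?N \<and> ?P")
proof -
  have "set_neighborhood G S = (\<Union>s \<in> S. epn G s S) \<longleftrightarrow> ?P"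
    by (auto simp: set_eq_iff mem_set_neighborhood_iff mem_epn_iff)
  moreover have "(\<forall>s \<in> S. epn G s S \<noteq> {}) \<longleftrightarrow> ?N" if ?P
    using that by (auto simp: ex_in_conv[symmetric] mem_epn_iff) blast+
  ultimately show ?thesis
    unfolding private_set_def by blast
qed

text \<open>Domination by the complement supplies the outside neighbors of \<open>T\<close>, and the bound of one
  uncovered neighbor is what makes them private.\<close>

lemma one_limited_dominating_set_Diff_iff:
  assumes "T \<subseteq> verts G"
  shows "one_limited_dominating_set G (verts G - T) \<longleftrightarrow> private_set G T"
proof -
  have compl: "verts G - (verts G - T) = T"
    using assms by blast
  have "(\<forall>v \<in> T. neighborhood G v \<inter> (verts G - T) \<noteq> {}) \<longleftrightarrow> (\<forall>s \<in> T. \<exists>v. v \<notin> T \<and> v \<rightarrow>\<^bsub>G\<^esub> s)"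
    using adj_in_verts dominates_sym by (auto simp: ex_in_conv[symmetric] mem_neighborhood_iff) blast+
  moreover have "card (neighborhood G v - (verts G - T)) \<le> 1 \<longleftrightarrow>
      (\<forall>s t. s \<in> T \<longrightarrow> t \<in> T \<longrightarrow> v \<rightarrow>\<^bsub>G\<^esub> s \<longrightarrow> v \<rightarrow>\<^bsub>G\<^esub> t \<longrightarrow> s = t)" for v
  proof -
    have "neighborhood G v - (verts G - T) = {t \<in> T. v \<rightarrow>\<^bsub>G\<^esub> t}"
      using adj_in_verts by (auto simp: mem_neighborhood_iff)
    moreover have "finite {t \<in> T. v \<rightarrow>\<^bsub>G\<^esub> t}"
      by (rule finite_subset[OF _ finite_neighborhood[of v]]) (auto simp: mem_neighborhood_iff)
    ultimately show ?thesis
      by (auto simp: card_le_Suc0_iff_eq)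
  qed
  ultimately show ?thesis
    unfolding one_limited_dominating_set_def dominating_set_def private_set_iff compl
    using assms adj_in_verts by (simp, blast)
qed

lemma connected_imp_ex_neighbor:
  assumes "connected G" "2 \<le> card (verts G)" "v \<in> verts G"
  obtains w where "v \<rightarrow>\<^bsub>G\<^esub> w"
proof -
  have "verts G \<noteq> {v}"
    using assms(2) by auto
  then obtain u where u: "u \<in> verts G" "u \<noteq> v"
    using assms(3) by blast
  have "v \<rightarrow>\<^sup>* u"
    using assms u reachable_mk_symmetric_eq[OF sym_arcs]
    by (auto simp: connected_def elim: strongly_connectedE)
  then show thesis
    using u that by (cases rule: converse_reachable_cases) auto
qed

text \<open>Small dominating sets correspond to large private sets. The bound is always attained, since
  a vertex with a neighbor forms a private set on its own.\<close>

lemma one_limited_domination_number_eq_iff: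
  assumes "connected G" "2 \<le> card (verts G)"
  shows "one_limited_domination_number G = card (verts G) - 1 \<longleftrightarrow>
    (\<forall>T. private_set G T \<longrightarrow> card T \<le> 1)"
proof -
  let ?A = "{card D | D. one_limited_dominating_set G D}"
  let ?n = "card (verts G)"
  have sub: "D \<subseteq> verts G" if "one_limited_dominating_set G D" for D
    using that unfolding one_limited_dominating_set_def dominating_set_def by simp
  have "?A \<subseteq> {..?n}"
    using card_mono[OF finite_verts sub] by auto
  then have fin: "finite ?A"
    by (rule finite_subset) simp
  have card_compl: "card (verts G - T) = ?n - card T" "card T \<le> ?n" if "private_set G T" for T
    using that finite_subset[OF _ finite_verts, of T]
    by (auto simp: private_set_def intro: card_Diff_subset card_mono)
  have A_eq: "?A = {?n - card T | T. private_set G T}"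
  proof (intro set_eqI iffI)
    fix k assume "k \<in> ?A"
    then obtain D where D: "k = card D" "one_limited_dominating_set G D"
      by blast
    then have "verts G - (verts G - D) = D"
      using sub by blast
    then have "private_set G (verts G - D)" "k = ?n - card (verts G - D)"
      using D one_limited_dominating_set_Diff_iff[of "verts G - D"] card_compl[of "verts G - D"]
      by auto
    then show "k \<in> {?n - card T | T. private_set G T}"
      by blast
  next
    fix k assume "k \<in> {?n - card T | T. private_set G T}"
    then obtain T where T: "k = ?n - card T" "private_set G T"
      by blast
    then have "one_limited_dominating_set G (verts G - T)"
      using one_limited_dominating_set_Diff_iff[of T] by (simp add: private_set_def)
    then show "k \<in> ?A"
      using T card_compl[of T] by force
  qed
  obtain x where x: "x \<in> verts G"
    using assms(2) by fastforce
  then obtain y where "x \<rightarrow>\<^bsub>G\<^esub> y"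
    using connected_imp_ex_neighbor assms by blast
  then have "y \<notin> {x} \<and> y \<rightarrow>\<^bsub>G\<^esub> x"
    using adj_not_same dominates_sym by blast
  then have "private_set G {x}"
    using x unfolding private_set_iff by blast
  then have mem: "?n - 1 \<in> ?A"
    unfolding A_eq by force
  have "one_limited_domination_number G = ?n - 1 \<longleftrightarrow> (\<forall>k \<in> ?A. ?n - 1 \<le> k)"
    unfolding one_limited_domination_number_def using fin mem Min_eq_iff[of ?A "?n - 1"] by blast
  also have "\<dots> \<longleftrightarrow> (\<forall>T. private_set G T \<longrightarrow> ?n - 1 \<le> ?n - card T)"
    unfolding A_eq by blast
  also have "\<dots> \<longleftrightarrow> (\<forall>T. private_set G T \<longrightarrow> card T \<le> 1)"
  proof -
    have "?n - 1 \<le> ?n - card T \<longleftrightarrow> card T \<le> 1" if "private_set G T" for T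
      using card_compl(2)[OF that] assms(2) by linarith
    then show ?thesis
      by blast
  qed
  finally show ?thesis .
qed

section \<open>Private pairs\<close>

lemma private_set_pair_iff:
  assumes "x \<noteq> y" "x \<in> verts G" "y \<in> verts G"
  shows "private_set G {x, y} \<longleftrightarrow>
    (\<exists>v. v \<noteq> y \<and> x \<rightarrow>\<^bsub>G\<^esub> v) \<and> (\<exists>v. v \<noteq> x \<and> y \<rightarrow>\<^bsub>G\<^esub> v) \<and> \<not> (\<exists>v. x \<rightarrow>\<^bsub>G\<^esub> v \<and> v \<rightarrow>\<^bsub>G\<^esub> y)"
proof
  assume P: "private_set G {x, y}"
  then have outside: "\<exists>v. v \<notin> {x, y} \<and> v \<rightarrow>\<^bsub>G\<^esub> s" if "s \<in> {x, y}" for s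
    using that unfolding private_set_iff by blast
  have "\<exists>v. v \<noteq> y \<and> x \<rightarrow>\<^bsub>G\<^esub> v" "\<exists>v. v \<noteq> x \<and> y \<rightarrow>\<^bsub>G\<^esub> v"
    using outside[of x] outside[of y] dominates_sym[of _ x] dominates_sym[of _ y] by blast+
  moreover have "\<not> (\<exists>v. x \<rightarrow>\<^bsub>G\<^esub> v \<and> v \<rightarrow>\<^bsub>G\<^esub> y)"
  proof
    assume "\<exists>v. x \<rightarrow>\<^bsub>G\<^esub> v \<and> v \<rightarrow>\<^bsub>G\<^esub> y"
    then obtain v where v: "x \<rightarrow>\<^bsub>G\<^esub> v" "v \<rightarrow>\<^bsub>G\<^esub> y"
      by blast
    then have "v \<notin> {x, y}"
      using adj_not_same by blast
    then have "x = y"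
      using P v(2) dominates_sym[OF v(1)] unfolding private_set_iff by blast
    then show False
      using assms(1) by contradiction
  qed
  ultimately show "(\<exists>v. v \<noteq> y \<and> x \<rightarrow>\<^bsub>G\<^esub> v) \<and> (\<exists>v. v \<noteq> x \<and> y \<rightarrow>\<^bsub>G\<^esub> v) \<and>
      \<not> (\<exists>v. x \<rightarrow>\<^bsub>G\<^esub> v \<and> v \<rightarrow>\<^bsub>G\<^esub> y)"
    by (intro conjI)
next
  assume "(\<exists>v. v \<noteq> y \<and> x \<rightarrow>\<^bsub>G\<^esub> v) \<and> (\<exists>v. v \<noteq> x \<and> y \<rightarrow>\<^bsub>G\<^esub> v) \<and>
      \<not> (\<exists>v. x \<rightarrow>\<^bsub>G\<^esub> v \<and> v \<rightarrow>\<^bsub>G\<^esub> y)"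
  then obtain a b where a: "a \<noteq> y" "x \<rightarrow>\<^bsub>G\<^esub> a" and b: "b \<noteq> x" "y \<rightarrow>\<^bsub>G\<^esub> b"
    and no_common: "\<And>v. x \<rightarrow>\<^bsub>G\<^esub> v \<Longrightarrow> \<not> v \<rightarrow>\<^bsub>G\<^esub> y"
    by blast
  have "a \<notin> {x, y}" "b \<notin> {x, y}"
    using a b adj_not_same by blast+
  then have "\<exists>v. v \<notin> {x, y} \<and> v \<rightarrow>\<^bsub>G\<^esub> s" if "s \<in> {x, y}" for s
    using that dominates_sym[OF a(2)] dominates_sym[OF b(2)] by blast
  moreover have "s = t"
    if "s \<in> {x, y}" "t \<in> {x, y}" "v \<rightarrow>\<^bsub>G\<^esub> s" "v \<rightarrow>\<^bsub>G\<^esub> t" for v s t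
    using that no_common[of v] dominates_sym[of v x] by auto
  moreover have "{x, y} \<subseteq> verts G"
    using assms(2,3) by simp
  ultimately show "private_set G {x, y}"
    unfolding private_set_iff by (intro conjI ballI allI impI)
qed

text \<open>A walk between distinct non-adjacent vertices without a common neighbor has at least three
  arcs; conversely, a common neighbor gives a walk with two.\<close>

lemma distance_le_two_iff:
  assumes "u \<in> verts G" "v \<in> verts G"
  shows "distance G u v \<le> 2 \<longleftrightarrow> u = v \<or> u \<rightarrow>\<^bsub>G\<^esub> v \<or> (\<exists>w. u \<rightarrow>\<^bsub>G\<^esub> w \<and> w \<rightarrow>\<^bsub>G\<^esub> v)"
proof
  assume near: "u = v \<or> u \<rightarrow>\<^bsub>G\<^esub> v \<or> (\<exists>w. u \<rightarrow>\<^bsub>G\<^esub> w \<and> w \<rightarrow>\<^bsub>G\<^esub> v)"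
  have "\<exists>p. awalk u p v \<and> length p \<le> 2"
    using near
  proof (elim disjE exE conjE)
    assume "u = v"
    then have "awalk u [] v"
      using assms by (simp add: awalk_Nil_iff)
    then show ?thesis
      by (intro exI[of _ "[]"]) simp
  next
    assume "u \<rightarrow>\<^bsub>G\<^esub> v"
    then obtain e where "e \<in> arcs G" "tail G e = u" "head G e = v"
      by (rule reachableE)
    then show ?thesis
      using assms by (intro exI[of _ "[e]"]) (simp add: awalk_simps)
  next
    fix w assume "u \<rightarrow>\<^bsub>G\<^esub> w" "w \<rightarrow>\<^bsub>G\<^esub> v"
    then obtain e f where "e \<in> arcs G" "tail G e = u" "head G e = w"
      "f \<in> arcs G" "tail G f = w" "head G f = v"
      by (elim reachableE) blast
    then show ?thesis
      using assms by (intro exI[of _ "[e, f]"]) (auto simp: awalk_simps)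
  qed
  then obtain p where p: "awalk u p v" "length p \<le> 2"
    by blast
  have "distance G u v \<le> ereal (awalk_cost (\<lambda>_. 1) p)"
    unfolding distance_def by (rule min_cost_le_walk_cost[OF p(1)])
  also have "\<dots> \<le> 2"
    using p(2) by (simp add: awalk_cost_def sum_list_triv)
  finally show "distance G u v \<le> 2" .
next
  assume le: "distance G u v \<le> 2"
  show "u = v \<or> u \<rightarrow>\<^bsub>G\<^esub> v \<or> (\<exists>w. u \<rightarrow>\<^bsub>G\<^esub> w \<and> w \<rightarrow>\<^bsub>G\<^esub> v)"
  proof (rule ccontr)
    assume far: "\<not> (u = v \<or> u \<rightarrow>\<^bsub>G\<^esub> v \<or> (\<exists>w. u \<rightarrow>\<^bsub>G\<^esub> w \<and> w \<rightarrow>\<^bsub>G\<^esub> v))"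
    have adj: "tail G e \<rightarrow>\<^bsub>G\<^esub> head G e" if "e \<in> arcs G" for e
      using that by (auto intro: dominatesI simp: arc_to_ends_def)
    have long: "3 \<le> length p" if p: "awalk u p v" for p
    proof (rule ccontr)
      assume "\<not> 3 \<le> length p"
      then consider "p = []" | e where "p = [e]" | e f where "p = [e, f]"
        by (cases p; cases "tl p"; cases "tl (tl p)") auto
      then show False
        using p far adj by cases (auto simp: awalk_simps, metis)
    qed
    have "3 \<le> distance G u v"
      unfolding distance_def \<mu>_def
    proof (rule INF_greatest)
      fix p assume "p \<in> {p. awalk u p v}"
      then have "3 \<le> length p"
        using long by simp
      then show "3 \<le> ereal (awalk_cost (\<lambda>_. 1) p)"
        by (simp add: awalk_cost_def sum_list_triv)
    qed
    then have "(3::ereal) \<le> 2"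
      using le by (rule order_trans)
    then show False
      by simp
  qed
qed

lemma diam_le_iff:
  assumes "verts G \<noteq> {}"
  shows "diam G \<le> k \<longleftrightarrow> (\<forall>u \<in> verts G. \<forall>v \<in> verts G. distance G u v \<le> k)"
proof -
  let ?A = "{distance G u v | u v. u \<in> verts G \<and> v \<in> verts G}"
  have "?A = (\<lambda>(u, v). distance G u v) ` (verts G \<times> verts G)"
    by auto
  then have "finite ?A" "?A \<noteq> {}"
    using assms by auto
  then show ?thesis
    unfolding diam_def by (subst Max_le_iff) auto
qed

text \<open>The absence of parallel arcs makes the out-degree count neighbors.\<close>

lemma out_degree_eq_1_iff:
  assumes "x \<rightarrow>\<^bsub>G\<^esub> y"
  shows "out_degree G x = 1 \<longleftrightarrow> \<not> (\<exists>v. v \<noteq> y \<and> x \<rightarrow>\<^bsub>G\<^esub> v)"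
proof -
  have "head G ` out_arcs G x = neighborhood G x"
    by (force simp: set_eq_iff mem_neighborhood_iff arcs_ends_conv)
  moreover have "inj_on (head G) (out_arcs G x)"
    by (auto intro!: inj_onI no_multi_arcs simp: arc_to_ends_def)
  ultimately have "out_degree G x = card (neighborhood G x)"
    unfolding out_degree_def by (metis card_image)
  moreover have "card (neighborhood G x) = 1 \<longleftrightarrow> neighborhood G x = {y}"
    using assms mem_neighborhood_iff[of y x] by (auto simp: card_1_singleton_iff)
  moreover have "neighborhood G x = {y} \<longleftrightarrow> \<not> (\<exists>v. v \<noteq> y \<and> x \<rightarrow>\<^bsub>G\<^esub> v)"
    using assms by (auto simp: set_eq_iff mem_neighborhood_iff)
  ultimately show ?thesis
    by simp
qed

lemma private_set_edge_iff:
  assumes "e \<in> arcs G"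
  shows "private_set G {tail G e, head G e} \<longleftrightarrow> \<not> pendant_edge G e \<and> \<not> in_triangle G e"
proof -
  have adj: "tail G e \<rightarrow>\<^bsub>G\<^esub> head G e"
    using assms by (auto intro: dominatesI simp: arc_to_ends_def)
  have "pendant_edge G e \<longleftrightarrow>
      \<not> (\<exists>v. v \<noteq> head G e \<and> tail G e \<rightarrow>\<^bsub>G\<^esub> v) \<or> \<not> (\<exists>v. v \<noteq> tail G e \<and> head G e \<rightarrow>\<^bsub>G\<^esub> v)"
    unfolding pendant_edge_def
    using assms out_degree_eq_1_iff[OF adj] out_degree_eq_1_iff[OF dominates_sym[OF adj]] by simp
  moreover have "in_triangle G e \<longleftrightarrow> (\<exists>v. tail G e \<rightarrow>\<^bsub>G\<^esub> v \<and> v \<rightarrow>\<^bsub>G\<^esub> head G e)"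
    unfolding in_triangle_def using assms adj_in_verts by blast
  ultimately show ?thesis
    using private_set_pair_iff[OF no_loops[OF assms]] assms by simp
qed

text \<open>If the edge avoids the universal vertex, that vertex is the third corner. Otherwise the other
  end of the edge has a further neighbor, which is also adjacent to the universal vertex.\<close>

lemma universal_vertex_imp_in_triangle:
  assumes u: "universal_vertex G u" and e: "e \<in> arcs G" "\<not> pendant_edge G e"
  shows "in_triangle G e"
proof (rule ccontr)
  assume "\<not> in_triangle G e"
  then have "private_set G {tail G e, head G e}"
    using private_set_edge_iff e by blast
  then have nbrs: "\<exists>v. v \<noteq> head G e \<and> tail G e \<rightarrow>\<^bsub>G\<^esub> v" "\<exists>v. v \<noteq> tail G e \<and> head G e \<rightarrow>\<^bsub>G\<^esub> v"
    and no_common: "\<not> (\<exists>v. tail G e \<rightarrow>\<^bsub>G\<^esub> v \<and> v \<rightarrow>\<^bsub>G\<^esub> head G e)"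
    using private_set_pair_iff[OF no_loops[OF e(1)]] e(1) by auto
  have univ: "u \<rightarrow>\<^bsub>G\<^esub> v" if "v \<in> verts G" "v \<noteq> u" for v
    using u that unfolding universal_vertex_def by blast
  consider "tail G e = u" | "head G e = u" | "tail G e \<noteq> u" "head G e \<noteq> u"
    by blast
  then show False
  proof cases
    case 1
    then show False
      using nbrs(2) no_common univ dominates_sym adj_in_verts by metis
  next
    case 2
    then show False
      using nbrs(1) no_common univ dominates_sym adj_in_verts by metis
  next
    case 3
    then show False
      using no_common univ[of "tail G e"] univ[of "head G e"] dominates_sym e(1) by auto
  qed
qed

text \<open>Here connectedness supplies the outside neighbors of a pair at distance greater than two:
  any neighbor of one vertex of such a pair differs from the other vertex.\<close>

lemma no_private_pair_iff:
  assumes "connected G" "2 \<le> card (verts G)"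
  shows "(\<forall>T. private_set G T \<longrightarrow> card T \<noteq> 2) \<longleftrightarrow>
    diam G \<le> 2 \<and> (\<forall>e \<in> arcs G. \<not> pendant_edge G e \<longrightarrow> in_triangle G e)"
    (is "?L \<longleftrightarrow> ?D \<and> ?E")
proof
  assume L: ?L
  have ?E
  proof (intro ballI impI)
    fix e assume e: "e \<in> arcs G" "\<not> pendant_edge G e"
    have "card {tail G e, head G e} = 2"
      using no_loops[OF e(1)] by simp
    then show "in_triangle G e"
      using L private_set_edge_iff[OF e(1)] e(2) by blast
  qed
  moreover have "distance G u v \<le> 2" if uv: "u \<in> verts G" "v \<in> verts G" for u v
  proof (rule ccontr)
    assume "\<not> distance G u v \<le> 2"
    then have far: "u \<noteq> v" "\<not> u \<rightarrow>\<^bsub>G\<^esub> v" "\<not> (\<exists>w. u \<rightarrow>\<^bsub>G\<^esub> w \<and> w \<rightarrow>\<^bsub>G\<^esub> v)"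
      using distance_le_two_iff[OF uv] by auto
    obtain a where a: "u \<rightarrow>\<^bsub>G\<^esub> a"
      by (rule connected_imp_ex_neighbor[OF assms uv(1)])
    obtain b where b: "v \<rightarrow>\<^bsub>G\<^esub> b"
      by (rule connected_imp_ex_neighbor[OF assms uv(2)])
    have "a \<noteq> v" "b \<noteq> u"
      using a b far(2) dominates_sym[of v u] by blast+
    then have "private_set G {u, v}"
      using private_set_pair_iff[OF far(1) uv] a b far(3) by blast
    moreover have "card {u, v} = 2"
      using far(1) by simp
    ultimately show False
      using L by blast
  qed
  moreover have "verts G \<noteq> {}"
    using assms(2) by auto
  ultimately show "?D \<and> ?E"
    using diam_le_iff[of 2] by blast
next
  assume R: "?D \<and> ?E"
  show ?L
  proof (intro allI impI notI)
    fix T assume T: "private_set G T" "card T = 2"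
    then obtain x y where xy: "T = {x, y}" "x \<noteq> y"
      by (auto simp: card_2_iff)
    have V: "x \<in> verts G" "y \<in> verts G"
      using T xy by (auto simp: private_set_def)
    have no_common: "\<not> (\<exists>v. x \<rightarrow>\<^bsub>G\<^esub> v \<and> v \<rightarrow>\<^bsub>G\<^esub> y)"
      using private_set_pair_iff[OF xy(2) V] T xy by simp
    have "verts G \<noteq> {}"
      using V by blast
    then have "distance G x y \<le> 2"
      using R V diam_le_iff[of 2] by blast
    then have "x \<rightarrow>\<^bsub>G\<^esub> y"
      using distance_le_two_iff[OF V] xy(2) no_common by blast
    then obtain e where "e \<in> arcs G" "tail G e = x" "head G e = y"
      by (rule reachableE)
    then show False
      using private_set_edge_iff[of e] T(1) xy(1) R by blast
  qed
qed

end

section \<open>Graphs of largest 1-limited domination number\<close>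

theorem theorem20:
  fixes G :: "('a, 'b) pre_digraph" and n :: nat
  assumes "graph G"
    and "Digraph_Component.connected G"
    and "card (verts G) = n"
    and "n \<ge> 3"
  shows "one_limited_domination_number G = n - 1 \<longleftrightarrow>
      diam G \<le> 2
    \<and> ((\<forall>e \<in> arcs G. \<not> pendant_edge G e \<longrightarrow> in_triangle G e) \<or> (\<exists>u. universal_vertex G u))
    \<and> \<not> (\<exists>S \<subseteq> verts G. card S \<ge> 3 \<and> (\<forall>s \<in> S. epn G s S \<noteq> {}) \<and>
           set_neighborhood G S = (\<Union>s \<in> S. epn G s S))"
proof -
  interpret graph G
    by (rule assms(1))
  have two: "2 \<le> card (verts G)"
    using assms(3,4) by simp
  have "one_limited_domination_number G = n - 1 \<longleftrightarrow> (\<forall>T. private_set G T \<longrightarrow> card T \<le> 1)"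
    using one_limited_domination_number_eq_iff[OF assms(2) two] assms(3) by simp
  also have "\<dots> \<longleftrightarrow> (\<forall>T. private_set G T \<longrightarrow> card T \<noteq> 2) \<and> \<not> (\<exists>T. private_set G T \<and> 3 \<le> card T)"
  proof -
    have "k \<le> 1 \<longleftrightarrow> k \<noteq> 2 \<and> \<not> 3 \<le> k" for k :: nat
      by arith
    then show ?thesis
      by blast
  qed
  also have "(\<forall>T. private_set G T \<longrightarrow> card T \<noteq> 2) \<longleftrightarrow> diam G \<le> 2 \<and>
      ((\<forall>e \<in> arcs G. \<not> pendant_edge G e \<longrightarrow> in_triangle G e) \<or> (\<exists>u. universal_vertex G u))"
    using no_private_pair_iff[OF assms(2) two] universal_vertex_imp_in_triangle by blast
  finally show ?thesis
    unfolding private_set_def by blast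
qed

end
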